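(* If $R$ is a quasiorder on $U$, then $\mathit{DRS}_R(U)=\{(X_R,-X^R)\mid X\subseteq U\}$ forms a Nelson algebra with the operations \begin{align*} (X_R,-X^R)\vee(Y_R,-Y^R)&=(X_R\cup Y_R,\,-X^R\cap -Y^R),\\ (X_R,-X^R)\wedge(Y_R,-Y^R)&=(X_R\cap Y_R,\,-X^R\cup -Y^R),\\ {\sim}(X_R,-X^R)&=(-X^R,\,X_R),\\ (X_R,-X^R)\to(Y_R,-Y^R)&=((-X_R\cup Y_R)_R,\,X_R\cap -Y^R). \end{align*}
   Context: A quasiorder on $U$ is a reflexive and transitive binary relation $R$ on $U$. Put $R(x)=\{y\in U\mid x\,R\,y\}$, and for $X\subseteq U$ let $X_R=\{x\in U\mid R(x)\subseteq X\}$ and $X^R=\{x\in U\mid R(x)\cap X\neq\emptyset\}$. Here $-X$ denotes $U\setminus X$, so $-X^R=U\setminus(X^R)$ and $-X_R=U\setminus(X_R)$. $\mathit{DRS}_R(U)$ is ordered by $(A,B)\le(C,D)$ iff $A\subseteq C$ and $B\supseteq D$; its $0$ is $(\emptyset,U)$ and its $1$ is $(U,\emptyset)$. A Kleene algebra $(A,\vee,\wedge,{\sim},0,1)$ is a bounded distributive lattice with a unary operation $\sim$ such that for all $a,b$: ${\sim}{\sim}a=a$; $a\le b$ iff ${\sim}b\le{\sim}a$; $a\wedge{\sim}a\le b\vee{\sim}b$. A Nelson algebra $(A,\vee,\wedge,\to,{\sim},0,1)$ is a Kleene algebra with a binary operation $\to$ such that for all $a,b,c$: $a\wedge c\le{\sim}a\vee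 b$ iff $c\le a\to b$; and $(a\wedge b)\to c=a\to(b\to c)$. *)

theory Defs
  imports "HOL-Algebra.Lattice"
begin

section \<open>Kleene algebras and Nelson algebras\<close>

text \<open>
  The operations \<open>\<squnion>\<close>, \<open>\<sqinter>\<close>, \<open>\<bottom>\<close>, \<open>\<top>\<close> are those that the underlying order determines in a
  bounded lattice; only the negation and the implication are further structure.
\<close>

record 'a kleene_struct = "'a gorder" +
  neg :: "'a \<Rightarrow> 'a"  ("\<sim>\<index> _" [81] 80)

record 'a nelson_struct = "'a kleene_struct" +
  imp :: "'a \<Rightarrow> 'a \<Rightarrow> 'a"  (infixr "\<leadsto>\<index>" 60)

locale kleene_algebra = bounded_lattice A for A (structure) +
  assumes meet_join_distrib:
      "\<lbrakk>a \<in> carrier A; b \<in> carrier A; c \<in> carrier A\<rbrakk>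
        \<Longrightarrow> a \<sqinter> (b \<squnion> c) = (a \<sqinter> b) \<squnion> (a \<sqinter> c)"
    and neg_closed: "a \<in> carrier A \<Longrightarrow> \<sim> a \<in> carrier A"
    and neg_neg: "a \<in> carrier A \<Longrightarrow> \<sim> (\<sim> a) = a"
    and neg_le_iff: "\<lbrakk>a \<in> carrier A; b \<in> carrier A\<rbrakk> \<Longrightarrow> a \<sqsubseteq> b \<longleftrightarrow> \<sim> b \<sqsubseteq> \<sim> a"
    and kleene: "\<lbrakk>a \<in> carrier A; b \<in> carrier A\<rbrakk> \<Longrightarrow> a \<sqinter> (\<sim> a) \<sqsubseteq> b \<squnion> (\<sim> b)"

locale nelson_algebra = kleene_algebra A for A (structure) +
  assumes imp_closed: "\<lbrakk>a \<in> carrier A; b \<in> carrier A\<rbrakk> \<Longrightarrow> a \<leadsto> b \<in> carrier A"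
    and imp_adjoint:
      "\<lbrakk>a \<in> carrier A; b \<in> carrier A; c \<in> carrier A\<rbrakk>
        \<Longrightarrow> a \<sqinter> c \<sqsubseteq> (\<sim> a) \<squnion> b \<longleftrightarrow> c \<sqsubseteq> (a \<leadsto> b)"
    and imp_curry:
      "\<lbrakk>a \<in> carrier A; b \<in> carrier A; c \<in> carrier A\<rbrakk>
        \<Longrightarrow> ((a \<sqinter> b) \<leadsto> c) = (a \<leadsto> (b \<leadsto> c))"


section \<open>Disjoint rough sets\<close>

text \<open>\<open>lower_approx R U X\<close> is $X_R$ and \<open>upper_approx R U X\<close> is $X^R$.\<close>

definition lower_approx :: "'a rel \<Rightarrow> 'a set \<Rightarrow> 'a set \<Rightarrow> 'a set" where
  "lower_approx R U X = {x \<in> U. R `` {x} \<subseteq> X}"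

definition upper_approx :: "'a rel \<Rightarrow> 'a set \<Rightarrow> 'a set \<Rightarrow> 'a set" where
  "upper_approx R U X = {x \<in> U. R `` {x} \<inter> X \<noteq> {}}"

definition disjoint_rough_set :: "'a rel \<Rightarrow> 'a set \<Rightarrow> 'a set \<Rightarrow> 'a set \<times> 'a set" where
  "disjoint_rough_set R U X = (lower_approx R U X, U - upper_approx R U X)"

text \<open>
  Negation and implication are given on arbitrary pairs, in terms of their components, so that
  they do not depend on the set \<open>X\<close> chosen to represent a pair $(X_R, -X^R)$.
\<close>

definition DRS :: "'a rel \<Rightarrow> 'a set \<Rightarrow> ('a set \<times> 'a set) nelson_struct" where
  "DRS R U =
    \<lparr> carrier = {disjoint_rough_set R U X | X. X \<subseteq> U},
      eq = (=),
      le = (\<lambda>(A, B) (C, D). A \<subseteq> C \<and> B \<supseteq> D),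
      neg = (\<lambda>(A, B). (B, A)),
      imp = (\<lambda>(A, B) (C, D). (lower_approx R U ((U - A) \<union> C), A \<inter> D)) \<rparr>"

end

theory Submission
  imports Defs
begin

text \<open>
  The pairs \<open>(X\<^sub>R, -X\<^sup>R)\<close> are exactly the disjoint pairs \<open>(A, B)\<close> of \<open>R\<close>-closed subsets of \<open>U\<close>
  such that \<open>A \<union> B\<close> contains every \<open>x\<close> with \<open>R(x) = {x}\<close>. This description is visibly stable under
  all the operations, and the Nelson laws become facts about sets. The difficult inclusion
  produces \<open>X\<close> from \<open>(A, B)\<close>: above the points \<open>x\<close> from which neither \<open>A\<close> nor \<open>B\<close> is reachable
  there is no \<open>y\<close> with \<open>R(y) = {y}\<close>, and one needs a set that is cofinal there together with its
  complement. Such a splitting comes from Zorn's lemma.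
\<close>

section \<open>Splitting a quasiorder into two cofinal parts\<close>

text \<open>
  A partial splitting is encoded as a set of coloured points \<open>(x, b)\<close>. Requiring only that every
  coloured point lie below a point of the other colour keeps the condition stable under unions
  of chains.
\<close>

definition coloured :: "'a rel \<Rightarrow> ('a \<times> bool) set \<Rightarrow> bool" where
  "coloured R Z \<longleftrightarrow>
    (\<forall>x b. (x, b) \<in> Z \<longrightarrow> (x, \<not> b) \<notin> Z \<and> (\<exists>y. (x, y) \<in> R \<and> (y, \<not> b) \<in> Z))"

text \<open>Disjoint supports keep any point from receiving both colours, and every witness survives
  in the union.\<close>

lemma coloured_Un:
  assumes "coloured R Z" "coloured R W" "fst ` Z \<inter> fst ` W = {}"
  shows "coloured R (Z \<union> W)"
proof -
  have "(x, b) \<notin> W" if "(x, c) \<in> Z" for x b c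
    using that assms(3) by force
  then show ?thesis
    using assms(1,2) unfolding coloured_def by blast
qed

lemma coloured_Union_chain:
  assumes "subset.chain {Z. coloured R Z} \<C>"
  shows "coloured R (\<Union>\<C>)"
proof -
  have C: "coloured R Z" if "Z \<in> \<C>" for Z
    using assms that by (auto simp: subset.chain_def)
  have "(x, \<not> b) \<notin> \<Union>\<C>" if x: "(x, b) \<in> \<Union>\<C>" for x b
  proof
    assume "(x, \<not> b) \<in> \<Union>\<C>"
    then obtain Z W where ZW: "Z \<in> \<C>" "W \<in> \<C>" "(x, b) \<in> Z" "(x, \<not> b) \<in> W"
      using x by blast
    then have "Z \<subseteq> W \<or> W \<subseteq> Z"
      using assms by (auto simp: subset_chain_def)
    then show False
      using ZW C unfolding coloured_def by blast
  qed
  moreover have "\<exists>y. (x, y) \<in> R \<and> (y, \<not> b) \<in> \<Union>\<C>" if "(x, b) \<in> \<Union>\<C>" for x b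
    using that C unfolding coloured_def by blast
  ultimately show ?thesis
    unfolding coloured_def by blast
qed

text \<open>The extension step for Zorn's lemma. Either some \<open>y\<close> above \<open>x\<close>
  is equivalent to everything above it, and a second point of its class takes the other colour, or
  one can climb strictly for ever and colour the chain alternately.\<close>

lemma coloured_above:
  assumes R: "preorder_on A R" and no_single: "\<And>y. y \<in> A \<Longrightarrow> R `` {y} \<noteq> {y}" and x: "x \<in> A"
  obtains W where "coloured R W" "W \<noteq> {}" "fst ` W \<subseteq> R `` {x}"
proof -
  have sub: "R \<subseteq> A \<times> A" and refl: "\<And>y. y \<in> A \<Longrightarrow> (y, y) \<in> R"
    and trans: "\<And>u v w. (u, v) \<in> R \<Longrightarrow> (v, w) \<in> R \<Longrightarrow> (u, w) \<in> R"
    using R by (auto simp: preorder_on_def refl_on_def trans_def)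
  show thesis
  proof (cases "\<exists>y. (x, y) \<in> R \<and> (\<forall>z. (y, z) \<in> R \<longrightarrow> (z, y) \<in> R)")
    case True
    then obtain y where y: "(x, y) \<in> R" "\<And>z. (y, z) \<in> R \<Longrightarrow> (z, y) \<in> R"
      by blast
    then have "y \<in> A"
      using sub by blast
    then obtain z where z: "(y, z) \<in> R" "z \<noteq> y"
      using no_single[of y] refl[of y] by blast
    show thesis
    proof
      show "coloured R {(y, True), (z, False)}"
        using y(2)[OF z(1)] z by (auto simp: coloured_def)
      show "fst ` {(y, True), (z, False)} \<subseteq> R `` {x}"
        using y(1) trans[OF y(1) z(1)] by simp
    qed simp
  next
    case False
    then have step: "\<exists>z. (x, z) \<in> R \<and> (y, z) \<in> R \<and> (z, y) \<notin> R" if "(x, y) \<in> R" for y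
      using that trans by blast
    obtain f where f: "\<And>n. (x, f n) \<in> R" "\<And>n. (f n, f (Suc n)) \<in> R \<and> (f (Suc n), f n) \<notin> R"
      using dependent_nat_choice[of "\<lambda>_ y. (x, y) \<in> R" "\<lambda>_ y z. (y, z) \<in> R \<and> (z, y) \<notin> R"]
        refl[OF x] step by metis
    have mono: "(f m, f n) \<in> R" if "m \<le> n" for m n
      using that
    proof (induction n rule: dec_induct)
      case base
      then show ?case using f(1) sub refl by blast
    next
      case (step n)
      then show ?case using f(2) trans by blast
    qed
    \<comment> \<open>A repetition \<open>f m = f n\<close> would put \<open>f m\<close> above
      \<open>f (Suc m)\<close>, against strictness. Injectivity makes the colour of
      \<open>f n\<close> well defined.\<close>
    have "f m \<noteq> f n" if "m < n" for m n
      using f(2)[of m] mono[of "Suc m" n] that by auto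
    then have inj: "f m = f n \<longleftrightarrow> m = n" for m n
      by (metis linorder_neqE_nat)
    show thesis
    proof
      show "coloured R (range (\<lambda>n. (f n, even n)))"
        unfolding coloured_def
      proof (intro allI impI conjI)
        fix y b
        assume "(y, b) \<in> range (\<lambda>n. (f n, even n))"
        then obtain n where n: "y = f n" "b = even n" by blast
        then show "(y, \<not> b) \<notin> range (\<lambda>n. (f n, even n))"
          by (auto simp: inj)
        have "(f (Suc n), \<not> b) \<in> range (\<lambda>n. (f n, even n))"
          using n by (intro image_eqI[of _ _ "Suc n"]) simp_all
        then show "\<exists>z. (y, z) \<in> R \<and> (z, \<not> b) \<in> range (\<lambda>n. (f n, even n))"
          using n f(2) by blast
      qed
      show "fst ` range (\<lambda>n. (f n, even n)) \<subseteq> R `` {x}"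
        using f(1) by auto
    qed simp
  qed
qed

text \<open>A maximal colouring has a coloured point above every \<open>x\<close>, since otherwise
  \<open>coloured_above\<close> would enlarge it. That point lies below one of the other colour, so
  both colour classes are cofinal.\<close>

lemma preorder_cofinal_split:
  assumes R: "preorder_on A R" and no_single: "\<And>y. y \<in> A \<Longrightarrow> R `` {y} \<noteq> {y}"
  obtains C D where "C \<inter> D = {}" "\<And>x. x \<in> A \<Longrightarrow> R `` {x} \<inter> C \<noteq> {} \<and> R `` {x} \<inter> D \<noteq> {}"
proof -
  have trans: "\<And>u v w. (u, v) \<in> R \<Longrightarrow> (v, w) \<in> R \<Longrightarrow> (u, w) \<in> R"
    using R by (auto simp: preorder_on_def trans_def)
  have "\<exists>Z\<in>{Z. coloured R Z}. \<forall>W\<in>{Z. coloured R Z}. Z \<subseteq> W \<longrightarrow> W = Z"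
    by (rule subset_Zorn') (simp add: coloured_Union_chain)
  then obtain Z where Z: "coloured R Z" and max: "\<And>W. coloured R W \<Longrightarrow> Z \<subseteq> W \<Longrightarrow> W = Z"
    by auto
  have reach: "\<exists>y b. (x, y) \<in> R \<and> (y, b) \<in> Z" if x: "x \<in> A" for x
  proof (rule ccontr)
    assume none: "\<nexists>y b. (x, y) \<in> R \<and> (y, b) \<in> Z"
    obtain W where W: "coloured R W" "W \<noteq> {}" "fst ` W \<subseteq> R `` {x}"
      using coloured_above[OF R no_single x] by blast
    then have "fst ` Z \<inter> fst ` W = {}"
      using none by force
    moreover from this have "Z \<union> W \<noteq> Z"
      using W(2) by blast
    ultimately show False
      using max coloured_Un[OF Z W(1)] by blast
  qed
  show thesis
  proof
    show "{x. (x, True) \<in> Z} \<inter> {x. (x, False) \<in> Z} = {}"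
      using Z unfolding coloured_def by force
    fix x
    assume "x \<in> A"
    then obtain y b where y: "(x, y) \<in> R" "(y, b) \<in> Z"
      using reach by blast
    then obtain z where z: "(y, z) \<in> R" "(z, \<not> b) \<in> Z"
      using Z unfolding coloured_def by blast
    show "R `` {x} \<inter> {x. (x, True) \<in> Z} \<noteq> {} \<and> R `` {x} \<inter> {x. (x, False) \<in> Z} \<noteq> {}"
      using y z trans[OF y(1) z(1)] by (cases b) auto
  qed
qed

section \<open>Disjoint rough sets as pairs of closed sets\<close>

definition singleton_points :: "'a rel \<Rightarrow> 'a set \<Rightarrow> 'a set" where
  "singleton_points R U = {x \<in> U. R `` {x} = {x}}"

lemma lower_approx_closed:
  assumes "R \<subseteq> U \<times> U" "trans R"
  shows "R `` lower_approx R U X \<subseteq> lower_approx R U X"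
proof -
  have "R `` {y} \<subseteq> R `` {x}" if "(x, y) \<in> R" for x y
    using assms(2) that by (auto dest: transD)
  then show ?thesis
    using assms(1) unfolding lower_approx_def by fast
qed

lemma preorder_on_carrier_DRS_iff:
  assumes R: "preorder_on U R"
  shows "(A, B) \<in> carrier (DRS R U) \<longleftrightarrow>
    A \<subseteq> U \<and> B \<subseteq> U \<and> R `` A \<subseteq> A \<and> R `` B \<subseteq> B \<and> A \<inter> B = {} \<and>
    singleton_points R U \<subseteq> A \<union> B"
    (is "?L \<longleftrightarrow> ?C")
proof -
  have sub: "R \<subseteq> U \<times> U" and refl: "\<And>y. y \<in> U \<Longrightarrow> (y, y) \<in> R"
    and trans: "\<And>u v w. (u, v) \<in> R \<Longrightarrow> (v, w) \<in> R \<Longrightarrow> (u, w) \<in> R"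
    using R by (auto simp: preorder_on_def refl_on_def trans_def)
  show ?thesis
  proof
    assume ?L
    then obtain X where X: "A = lower_approx R U X" "B = U - upper_approx R U X"
      by (auto simp: DRS_def disjoint_rough_set_def)
    have "R `` A \<subseteq> A"
      using R unfolding X by (simp add: preorder_on_def lower_approx_closed)
    moreover have "R `` B \<subseteq> B"
      using sub trans unfolding X upper_approx_def by blast
    moreover have "A \<inter> B = {}"
      using refl unfolding X lower_approx_def upper_approx_def by blast
    moreover have "singleton_points R U \<subseteq> A \<union> B"
    proof
      fix x
      assume "x \<in> singleton_points R U"
      \<comment> \<open>Here R(x) = {x}, so it is contained in \<open>X\<close> or disjoint from
        it.\<close>
      then show "x \<in> A \<union> B"
        unfolding X
        by (cases "x \<in> X") (simp_all add: singleton_points_def lower_approx_def upper_approx_def)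
    qed
    ultimately show ?C
      unfolding X lower_approx_def by blast
  next
    assume C: ?C
    \<comment> \<open>The points that see neither \<open>A\<close> nor \<open>B\<close>. This set is
      closed under \<open>R\<close>, so restricting \<open>R\<close> to it keeps all successor sets,
      and it contains no singleton point because those lie in \<open>A \<union> B\<close>.\<close>
    define H where "H = {x \<in> U. R `` {x} \<inter> (A \<union> B) = {}}"
    define S where "S = R \<inter> H \<times> H"
    have closed: "y \<in> H" if "x \<in> H" "(x, y) \<in> R" for x y
      using that sub trans unfolding H_def by blast
    have S: "S `` {x} = R `` {x}" if "x \<in> H" for x
      using that closed unfolding S_def by blast
    have "preorder_on H S"
      using refl trans unfolding preorder_on_def refl_on_def S_def
      by (auto simp: H_def intro!: transI)
    moreover have "S `` {x} \<noteq> {x}" if "x \<in> H" for x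
      using that C unfolding S[OF that] H_def singleton_points_def by blast
    ultimately obtain P Q where PQ: "P \<inter> Q = {}"
        "\<And>x. x \<in> H \<Longrightarrow> S `` {x} \<inter> P \<noteq> {} \<and> S `` {x} \<inter> Q \<noteq> {}"
      by (rule preorder_cofinal_split) auto
    text \<open>A point that sees neither \<open>A\<close> nor \<open>B\<close> is separated by the splitting, one that sees both by
      \<open>A\<close> and \<open>B\<close>, and one that sees a single one of them by that set and the point itself.\<close>
    define X where "X = A \<union> (P \<inter> H) \<union> {x \<in> U - B. R `` {x} \<inter> B \<noteq> {} \<and> R `` {x} \<inter> A = {}}"
    have XU: "X \<subseteq> U"
      using C unfolding X_def H_def by blast
    have XB: "X \<inter> B = {}"
      using C refl unfolding X_def H_def by blast
    \<comment> \<open>Points outside \<open>A \<union> B\<close> must be boundary points of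
      \<open>X\<close>; this is what keeps the approximations of \<open>X\<close> from exceeding
      \<open>A\<close> and \<open>B\<close>.\<close>
    have split: "\<not> R `` {x} \<subseteq> X \<and> R `` {x} \<inter> X \<noteq> {}" if x: "x \<in> U" "x \<notin> A" "x \<notin> B" for x
    proof (cases "x \<in> H")
      case True
      then have "R `` {x} \<inter> P \<inter> H \<noteq> {}" "R `` {x} \<inter> Q \<inter> H \<noteq> {}"
        using PQ(2)[OF True] closed[OF True] S[OF True] by blast+
      moreover have "Q \<inter> H \<inter> X = {}"
        using PQ(1) refl unfolding X_def H_def by blast
      ultimately show ?thesis
        unfolding X_def by blast
    next
      case False
      show ?thesis
      proof (cases "R `` {x} \<inter> A = {}")
        case True
        then have "R `` {x} \<inter> B \<noteq> {}" "x \<in> X"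
          using False x unfolding H_def X_def by blast+
        then show ?thesis
          using XB refl[OF x(1)] by blast
      next
        case nonempty: False
        \<comment> \<open>Seeing \<open>A\<close> bars \<open>x\<close> from the third piece of
          \<open>X\<close>, so \<open>x\<close> itself witnesses non-inclusion whether or not it
          sees \<open>B\<close>.\<close>
        then have "x \<notin> X"
          using False x unfolding X_def by blast
        then show ?thesis
          using nonempty refl[OF x(1)] unfolding X_def by blast
      qed
    qed
    have "A \<subseteq> lower_approx R U X"
      using C unfolding lower_approx_def X_def by blast
    moreover have "lower_approx R U X \<subseteq> A"
      using split XB refl unfolding lower_approx_def by blast
    moreover have "B \<subseteq> U - upper_approx R U X"
      using C XB unfolding upper_approx_def by blast
    moreover have "U - upper_approx R U X \<subseteq> B"
      using split refl unfolding upper_approx_def X_def by blast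
    ultimately have "(A, B) = disjoint_rough_set R U X"
      unfolding disjoint_rough_set_def by blast
    then show ?L
      using XU by (auto simp: DRS_def)
  qed
qed

section \<open>The lattice of disjoint rough sets\<close>

lemma le_DRS [simp]: "(A, B) \<sqsubseteq>\<^bsub>DRS R U\<^esub> (C, D) \<longleftrightarrow> A \<subseteq> C \<and> D \<subseteq> B"
  and eq_DRS [simp]: "eq (DRS R U) = (=)"
  and neg_DRS [simp]: "\<sim>\<^bsub>DRS R U\<^esub> (A, B) = (B, A)"
  and imp_DRS [simp]: "(A, B) \<leadsto>\<^bsub>DRS R U\<^esub> (C, D) = (lower_approx R U ((U - A) \<union> C), A \<inter> D)"
  by (auto simp: DRS_def)

lemma partial_order_DRS: "partial_order (DRS R U)"
proof unfold_locales
  fix x y z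
  show "x \<sqsubseteq>\<^bsub>DRS R U\<^esub> y \<Longrightarrow> y \<sqsubseteq>\<^bsub>DRS R U\<^esub> z \<Longrightarrow> x \<sqsubseteq>\<^bsub>DRS R U\<^esub> z"
    by (cases x; cases y; cases z) (auto simp only: le_DRS subset_iff)
qed auto

text \<open>Joins, meets and bounds are Hilbert choices; uniqueness of least and greatest elements
  identifies each with an explicit pair.\<close>

lemma (in partial_order) join_eqI:
  "least L s (Upper L {x, y}) \<Longrightarrow> x \<squnion> y = s"
  unfolding join_def sup_def by (rule some_equality) (auto intro: least_unique)

lemma (in partial_order) meet_eqI:
  "greatest L s (Lower L {x, y}) \<Longrightarrow> x \<sqinter> y = s"
  unfolding meet_def inf_def by (rule some_equality) (auto intro: greatest_unique)

lemma (in partial_order) bottom_eqI: "least L s (carrier L) \<Longrightarrow> \<bottom> = s"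
  unfolding bottom_def by (rule some_equality) (auto intro: least_unique)

lemma (in partial_order) top_eqI: "greatest L s (carrier L) \<Longrightarrow> \<top> = s"
  unfolding top_def by (rule some_equality) (auto intro: greatest_unique)

context
  fixes U :: "'a set" and R :: "'a rel"
  assumes R: "preorder_on U R"
begin

interpretation partial_order "DRS R U"
  by (rule partial_order_DRS)

lemmas carrier_iff = preorder_on_carrier_DRS_iff[OF R]

text \<open>Closed sets are stable under union and intersection. A singleton point outside
  \<open>A \<union> C\<close> lies in both \<open>B\<close> and \<open>D\<close>, so the covering
  condition persists.\<close>

lemma least_Upper_DRS:
  assumes "(A, B) \<in> carrier (DRS R U)" "(C, D) \<in> carrier (DRS R U)"
  shows "least (DRS R U) (A \<union> C, B \<inter> D) (Upper (DRS R U) {(A, B), (C, D)})"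
proof -
  have "R `` A \<subseteq> A" "R `` B \<subseteq> B" "R `` C \<subseteq> C" "R `` D \<subseteq> D"
    using assms by (simp_all add: carrier_iff)
  then have "R `` (A \<union> C) \<subseteq> A \<union> C" "R `` (B \<inter> D) \<subseteq> B \<inter> D"
    by blast+
  then have "(A \<union> C, B \<inter> D) \<in> carrier (DRS R U)"
    using assms unfolding carrier_iff by blast
  then show ?thesis
    using assms by (auto simp: least_def Upper_def)
qed

lemma greatest_Lower_DRS:
  assumes "(A, B) \<in> carrier (DRS R U)" "(C, D) \<in> carrier (DRS R U)"
  shows "greatest (DRS R U) (A \<inter> C, B \<union> D) (Lower (DRS R U) {(A, B), (C, D)})"
proof -
  have "R `` A \<subseteq> A" "R `` B \<subseteq> B" "R `` C \<subseteq> C" "R `` D \<subseteq> D"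
    using assms by (simp_all add: carrier_iff)
  then have "R `` (A \<inter> C) \<subseteq> A \<inter> C" "R `` (B \<union> D) \<subseteq> B \<union> D"
    by blast+
  then have "(A \<inter> C, B \<union> D) \<in> carrier (DRS R U)"
    using assms unfolding carrier_iff by blast
  then show ?thesis
    using assms by (auto simp: greatest_def Lower_def)
qed

lemmas join_DRS = join_eqI[OF least_Upper_DRS]
lemmas meet_DRS = meet_eqI[OF greatest_Lower_DRS]

lemma least_DRS: "least (DRS R U) ({}, U) (carrier (DRS R U))"
proof -
  have "({}, U) \<in> carrier (DRS R U)"
    using R unfolding carrier_iff by (auto simp: preorder_on_def singleton_points_def)
  moreover have "({}, U) \<sqsubseteq>\<^bsub>DRS R U\<^esub> p" if "p \<in> carrier (DRS R U)" for p
    using that by (cases p) (simp add: carrier_iff)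
  ultimately show ?thesis
    by (simp add: least_def)
qed

lemma greatest_DRS: "greatest (DRS R U) (U, {}) (carrier (DRS R U))"
proof -
  have "(U, {}) \<in> carrier (DRS R U)"
    using R unfolding carrier_iff by (auto simp: preorder_on_def singleton_points_def)
  moreover have "p \<sqsubseteq>\<^bsub>DRS R U\<^esub> (U, {})" if "p \<in> carrier (DRS R U)" for p
    using that by (cases p) (simp add: carrier_iff)
  ultimately show ?thesis
    by (simp add: greatest_def)
qed

lemma bounded_lattice_DRS: "bounded_lattice (DRS R U)"
proof unfold_locales
  fix x y
  assume "x \<in> carrier (DRS R U)" "y \<in> carrier (DRS R U)"
  then show "\<exists>s. least (DRS R U) s (Upper (DRS R U) {x, y})"
    and "\<exists>s. greatest (DRS R U) s (Lower (DRS R U) {x, y})"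
    by (cases x; cases y; blast intro: least_Upper_DRS greatest_Lower_DRS)+
qed (use least_DRS greatest_DRS in blast)+

section \<open>Negation and the Kleene laws\<close>

lemma neg_closed_DRS: "(A, B) \<in> carrier (DRS R U) \<Longrightarrow> (B, A) \<in> carrier (DRS R U)"
  unfolding carrier_iff by blast

lemma kleene_algebra_DRS: "kleene_algebra (DRS R U)"
proof (intro kleene_algebra.intro kleene_algebra_axioms.intro bounded_lattice_DRS)
  interpret bounded_lattice "DRS R U"
    by (rule bounded_lattice_DRS)
  fix a b c
  assume a: "a \<in> carrier (DRS R U)"
  obtain A B where a_eq [simp]: "a = (A, B)"
    by fastforce
  show "\<sim>\<^bsub>DRS R U\<^esub> a \<in> carrier (DRS R U)" "\<sim>\<^bsub>DRS R U\<^esub> (\<sim>\<^bsub>DRS R U\<^esub> a) = a"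
    using a neg_closed_DRS by simp_all
  assume b: "b \<in> carrier (DRS R U)"
  obtain C D where b_eq [simp]: "b = (C, D)"
    by fastforce
  show "a \<sqsubseteq>\<^bsub>DRS R U\<^esub> b \<longleftrightarrow> \<sim>\<^bsub>DRS R U\<^esub> b \<sqsubseteq>\<^bsub>DRS R U\<^esub> \<sim>\<^bsub>DRS R U\<^esub> a"
    by auto
  \<comment> \<open>Disjointness empties the first component of \<open>a\<close> met with its
    negation and the second component of \<open>b\<close> joined with its negation.\<close>
  have "A \<inter> B = {}" "C \<inter> D = {}"
    using a b by (simp_all add: carrier_iff)
  then show "a \<sqinter>\<^bsub>DRS R U\<^esub> \<sim>\<^bsub>DRS R U\<^esub> a \<sqsubseteq>\<^bsub>DRS R U\<^esub> b \<squnion>\<^bsub>DRS R U\<^esub> \<sim>\<^bsub>DRS R U\<^esub> b"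
    using a b by (simp add: meet_DRS join_DRS neg_closed_DRS Int_commute)
  assume c: "c \<in> carrier (DRS R U)"
  obtain E F where c_eq [simp]: "c = (E, F)"
    by fastforce
  have "(C \<union> E, D \<inter> F) \<in> carrier (DRS R U)"
    using join_closed[OF b c] b c by (simp add: join_DRS)
  moreover have "(A \<inter> C, B \<union> D) \<in> carrier (DRS R U)" "(A \<inter> E, B \<union> F) \<in> carrier (DRS R U)"
    using meet_closed[OF a b] meet_closed[OF a c] a b c by (simp_all add: meet_DRS)
  ultimately show "a \<sqinter>\<^bsub>DRS R U\<^esub> (b \<squnion>\<^bsub>DRS R U\<^esub> c) =
      (a \<sqinter>\<^bsub>DRS R U\<^esub> b) \<squnion>\<^bsub>DRS R U\<^esub> (a \<sqinter>\<^bsub>DRS R U\<^esub> c)"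
    using a b c by (simp add: meet_DRS join_DRS) blast
qed

section \<open>Implication and the Nelson laws\<close>

lemma imp_closed_DRS:
  assumes "(A, B) \<in> carrier (DRS R U)" "(C, D) \<in> carrier (DRS R U)"
  shows "(lower_approx R U ((U - A) \<union> C), A \<inter> D) \<in> carrier (DRS R U)"
proof -
  have refl: "\<And>y. y \<in> U \<Longrightarrow> (y, y) \<in> R"
    using R by (auto simp: preorder_on_def refl_on_def)
  let ?L = "lower_approx R U ((U - A) \<union> C)"
  have "R `` ?L \<subseteq> ?L"
    using R by (simp add: preorder_on_def lower_approx_closed)
  \<comment> \<open>Modus ponens for the first components; with \<open>C\<close> and
    \<open>D\<close> disjoint it separates the two components of the implication.\<close>
  moreover have "?L \<inter> A \<subseteq> C"
    using refl unfolding lower_approx_def by blast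
  then have "?L \<inter> (A \<inter> D) = {}"
    using assms(2) unfolding carrier_iff by blast
  moreover have "singleton_points R U \<subseteq> ?L \<union> A \<inter> D"
  proof
    fix x
    assume x: "x \<in> singleton_points R U"
    \<comment> \<open>If \<open>x\<close> is in \<open>C\<close> or outside \<open>A\<close>, its
      only successor \<open>x\<close> puts it in \<open>?L\<close>; otherwise it lies in
      \<open>A \<inter> D\<close>.\<close>
    then have "x \<in> C \<union> D"
      using assms(2) unfolding carrier_iff by blast
    then show "x \<in> ?L \<union> A \<inter> D"
      using x by (auto simp: lower_approx_def singleton_points_def)
  qed
  moreover have "?L \<subseteq> U"
    unfolding lower_approx_def by blast
  moreover have "A \<subseteq> U" "R `` A \<subseteq> A" "R `` D \<subseteq> D"
    using assms by (simp_all add: carrier_iff)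
  then have "A \<inter> D \<subseteq> U" "R `` (A \<inter> D) \<subseteq> A \<inter> D"
    by blast+
  ultimately show ?thesis
    unfolding carrier_iff by simp
qed

lemma nelson_algebra_DRS: "nelson_algebra (DRS R U)"
proof (intro nelson_algebra.intro nelson_algebra_axioms.intro kleene_algebra_DRS)
  have sub: "R \<subseteq> U \<times> U" and refl: "\<And>y. y \<in> U \<Longrightarrow> (y, y) \<in> R"
    and trans: "\<And>u v w. (u, v) \<in> R \<Longrightarrow> (v, w) \<in> R \<Longrightarrow> (u, w) \<in> R"
    using R by (auto simp: preorder_on_def refl_on_def trans_def)
  fix a b c
  assume a: "a \<in> carrier (DRS R U)" and b: "b \<in> carrier (DRS R U)"
  obtain A B C D where ab_eq [simp]: "a = (A, B)" "b = (C, D)"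
    by fastforce
  have A: "A \<subseteq> U" "R `` A \<subseteq> A" "A \<inter> B = {}"
    using a by (simp_all add: carrier_iff)
  show "a \<leadsto>\<^bsub>DRS R U\<^esub> b \<in> carrier (DRS R U)"
    using a b imp_closed_DRS by simp
  assume c: "c \<in> carrier (DRS R U)"
  obtain E F where c_eq [simp]: "c = (E, F)"
    by fastforce
  have E: "E \<subseteq> U" "R `` E \<subseteq> E"
    using c by (simp_all add: carrier_iff)
  \<comment> \<open>A closed set lies in a lower approximation as soon as it lies in the
    approximated set, so this is the Heyting adjunction for closed sets. As \<open>B\<close> misses
    \<open>A\<close>, adding \<open>B\<close> on the right changes nothing.\<close>
  have "E \<subseteq> lower_approx R U ((U - A) \<union> C) \<longleftrightarrow> A \<inter> E \<subseteq> C"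
    using E refl unfolding lower_approx_def by blast
  also have "\<dots> \<longleftrightarrow> A \<inter> E \<subseteq> B \<union> C"
    using A by blast
  finally have "E \<subseteq> lower_approx R U ((U - A) \<union> C) \<longleftrightarrow> A \<inter> E \<subseteq> B \<union> C" .
  moreover have "A \<inter> D \<subseteq> B \<union> F \<longleftrightarrow> A \<inter> D \<subseteq> F"
    using A by blast
  ultimately show "a \<sqinter>\<^bsub>DRS R U\<^esub> c \<sqsubseteq>\<^bsub>DRS R U\<^esub> (\<sim>\<^bsub>DRS R U\<^esub> a) \<squnion>\<^bsub>DRS R U\<^esub> b \<longleftrightarrow>
      c \<sqsubseteq>\<^bsub>DRS R U\<^esub> (a \<leadsto>\<^bsub>DRS R U\<^esub> b)"
    using a b c by (simp add: meet_DRS join_DRS neg_closed_DRS)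
  \<comment> \<open>Currying of the Heyting implication on first components; second components agree
    by associativity of intersection.\<close>
  have "lower_approx R U ((U - A \<inter> C) \<union> E) \<subseteq>
      lower_approx R U ((U - A) \<union> lower_approx R U ((U - C) \<union> E))"
  proof
    fix x
    assume "x \<in> lower_approx R U ((U - A \<inter> C) \<union> E)"
    then have x: "x \<in> U" "\<And>z. (x, z) \<in> R \<Longrightarrow> z \<notin> A \<inter> C \<or> z \<in> E"
      by (auto simp: lower_approx_def)
    \<comment> \<open>Closedness of \<open>A\<close> carries membership from \<open>y\<close> to
      \<open>z\<close>, so \<open>z \<notin> A \<inter> C\<close> reduces to
      \<open>z \<notin> C\<close>.\<close>
    have "z \<in> (U - C) \<union> E" if "(x, y) \<in> R" "y \<in> A" "(y, z) \<in> R" for y z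
      using x(2)[of z] trans[OF that(1,3)] that A(2) sub by blast
    then show "x \<in> lower_approx R U ((U - A) \<union> lower_approx R U ((U - C) \<union> E))"
      using x(1) sub by (auto simp: lower_approx_def)
  qed
  moreover have "lower_approx R U ((U - A) \<union> lower_approx R U ((U - C) \<union> E)) \<subseteq>
      lower_approx R U ((U - A \<inter> C) \<union> E)"
    using sub refl unfolding lower_approx_def by blast
  ultimately show "(a \<sqinter>\<^bsub>DRS R U\<^esub> b) \<leadsto>\<^bsub>DRS R U\<^esub> c = a \<leadsto>\<^bsub>DRS R U\<^esub> (b \<leadsto>\<^bsub>DRS R U\<^esub> c)"
    using a b by (simp add: meet_DRS Int_assoc)
qed

end

theorem proposition4p4:
  fixes U :: "'a set" and R :: "'a rel"
  assumes "preorder_on U R"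
  shows "nelson_algebra (DRS R U) \<and>
    \<bottom>\<^bsub>DRS R U\<^esub> = ({}, U) \<and>
    \<top>\<^bsub>DRS R U\<^esub> = (U, {}) \<and>
    (\<forall>X Y. X \<subseteq> U \<and> Y \<subseteq> U \<longrightarrow>
      disjoint_rough_set R U X \<squnion>\<^bsub>DRS R U\<^esub> disjoint_rough_set R U Y =
        (lower_approx R U X \<union> lower_approx R U Y,
         (U - upper_approx R U X) \<inter> (U - upper_approx R U Y)) \<and>
      disjoint_rough_set R U X \<sqinter>\<^bsub>DRS R U\<^esub> disjoint_rough_set R U Y =
        (lower_approx R U X \<inter> lower_approx R U Y,
         (U - upper_approx R U X) \<union> (U - upper_approx R U Y)) \<and>
      \<sim>\<^bsub>DRS R U\<^esub> (disjoint_rough_set R U X) =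
        (U - upper_approx R U X, lower_approx R U X) \<and>
      disjoint_rough_set R U X \<leadsto>\<^bsub>DRS R U\<^esub> disjoint_rough_set R U Y =
        (lower_approx R U ((U - lower_approx R U X) \<union> lower_approx R U Y),
         lower_approx R U X \<inter> (U - upper_approx R U Y)))"
proof -
  interpret partial_order "DRS R U"
    by (rule partial_order_DRS)
  have "disjoint_rough_set R U X \<in> carrier (DRS R U)" if "X \<subseteq> U" for X
    using that by (auto simp: DRS_def)
  then have carrier: "(lower_approx R U X, U - upper_approx R U X) \<in> carrier (DRS R U)"
    if "X \<subseteq> U" for X
    using that by (simp add: disjoint_rough_set_def)
  show ?thesis
    using nelson_algebra_DRS[OF assms] bottom_eqI[OF least_DRS[OF assms]]
      top_eqI[OF greatest_DRS[OF assms]]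
    by (simp add: disjoint_rough_set_def carrier join_DRS[OF assms] meet_DRS[OF assms])
qed

end
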